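(* Consider the early-exaggeration iterates $y_i^{(k)}\in\mathbb R^2$ with parameters $(\alpha,h)$ and iteration index $k\ge 1$ (all possibly depending on $n$). Suppose that, as $n\to\infty$, (i) $\min_{\ell\in\{1,2\}}\|\mathbf y_\ell^{(0)}\|_2>0$ and $\max_{\ell\in\{1,2\}}\|\mathbf y_\ell^{(0)}\|_\infty=O(1)$; (ii) $\max_{\ell\in\{1,2\}}\|\mathbf y_\ell^{(0)}\|_\infty^2=o\big(\|\mathbf P\|/(n\|\mathbf P\|_\infty)\big)$; (iii) $\alpha\gg(n\|\mathbf P\|)^{-1}$ and $k(nh\alpha\|\mathbf P\|_\infty+h/n)=o(1)$. Then, with $\mathbf H_n=\frac1{n(n-1)}(\mathbf 1_n\mathbf 1_n^\top-\mathbf I_n)$: $$\lim_{n\to\infty}\frac{\|\mathbf S_\alpha^{(k)}-(\alpha\mathbf P-\mathbf H_n)\|}{\|\alpha\mathbf P-\mathbf H_n\|}=0;$$ for some universal constant $C>0$, $$\mathrm{diam}(\{y_i^{(k+1)}\}_{1\le i\le n})\le C\max_{\ell\in\{1,2\}}\|\mathbf y_\ell^{(0)}\|_\infty;$$ and for $\ell\in\{1,2\}$, $$\lim_{n\to\infty}\frac{\|\mathbf y_\ell^{(k)}-[\mathbf I_n-h\mathbf L(\alpha\mathbf P-\mathbf H_n)]^k\mathbf y_\ell^{(0)}\|_2}{\|\mathbf y_\ell^{(0)}\|_2}=0.$$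
   Context: For each $n\ge2$ there are data points $X_1,\dots,X_n\in\mathbb R^p$ ($p$ and the data may depend on $n$) and bandwidths $\tau_i>0$. The matrix $\mathbf P=(p_{ij})\in\mathbb R^{n\times n}$ is given by $p_{ii}=0$ and, for $i\ne j$, $p_{ij}=\frac{p_{i|j}+p_{j|i}}{2n}$ with $p_{j|i}=\frac{\exp(-\|X_i-X_j\|_2^2/2\tau_i^2)}{\sum_{\ell\ne i}\exp(-\|X_i-X_\ell\|_2^2/2\tau_i^2)}$. Early exaggeration iterates: from an initialization $y_1^{(0)},\dots,y_n^{(0)}\in\mathbb R^2$ and parameters $\alpha>0$, $h>0$, $y_i^{(k+1)}=y_i^{(k)}+h\sum_{j\ne i}(y_j^{(k)}-y_i^{(k)})S_{ij}^{(k)}(\alpha)$, where for $i\ne j$, $S_{ij}^{(k)}(\alpha)=\frac{\alpha p_{ij}-q_{ij}^{(k)}}{1+\|y_i^{(k)}-y_j^{(k)}\|_2^2}$ and $q_{ij}^{(k)}=\frac{(1+\|y_i^{(k)}-y_j^{(k)}\|_2^2)^{-1}}{\sum_{\ell\ne s}(1+\|y_\ell^{(k)}-y_s^{(k)}\|_2^2)^{-1}}$; $S_{ii}^{(k)}(\alpha)=0$; $\mathbf S_\alpha^{(k)}=(S_{ij}^{(k)}(\alpha))_{i,j}$. For $\ell\in\{1,2\}$, $\mathbf y_\ell^{(k)}\in\mathbb R^n$ is the vector of $\ell$-th coordinates of $y_1^{(k)},\dots,y_n^{(k)}$. For symmetric $\mathbf A$, $\mathbf L(\mathbf A)=\mathbf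 D(\mathbf A)-\mathbf A$ with $\mathbf D(\mathbf A)=\mathrm{diag}(\sum_i a_{i1},\dots,\sum_i a_{in})$. $\|\cdot\|$ is the spectral norm, $\|\mathbf A\|_\infty=\max_{i,j}|a_{ij}|$ for matrices (sup norm for vectors), $\mathrm{diam}(S)=\sup_{x,y\in S}\|x-y\|_2$, $\mathbf I_n$ the identity matrix, $\mathbf 1_n$ the all-ones vector; $a_n\ll b_n$ (equivalently $b_n\gg a_n$, $a_n=o(b_n)$) means $a_n/b_n\to0$ as $n\to\infty$; $a_n=O(b_n)$ means $a_n\le Cb_n$ for all $n$ for some constant $C$. *)

theory Defs
  imports
    "HOL-Analysis.Analysis"
    "HOL-Library.Landau_Symbols"
    "Jordan_Normal_Form.Matrix"
begin

text \<open>Since the number \<open>n\<close> of points tends to infinity, the \<open>n\<close>-dimensional vectors and the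
  \<open>n \<times> n\<close> matrices are those of \<^theory>\<open>Jordan_Normal_Form.Matrix\<close>, with indices running
  over \<open>{0..<n}\<close>. The same holds for the data points, whose dimension may depend on \<open>n\<close>.
  The embedded points live in the fixed space \<open>real ^ 2\<close>; the index type \<open>2\<close> has exactly two
  elements. A configuration of \<open>n\<close> points is a function on \<open>nat\<close>, of which only the
  values at arguments below \<open>n\<close> are relevant.\<close>

definition vec_l2_norm :: "real Matrix.vec \<Rightarrow> real" where
  "vec_l2_norm v = sqrt (scalar_prod v v)"

definition vec_sup_norm :: "real Matrix.vec \<Rightarrow> real" where
  "vec_sup_norm v = Max {\<bar>vec_index v i\<bar> | i. i < dim_vec v}"

definition spectral_norm :: "real Matrix.mat \<Rightarrow> real" where
  "spectral_norm A = Sup {vec_l2_norm (A *\<^sub>v v) | v.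
     v \<in> carrier_vec (dim_col A) \<and> vec_l2_norm v \<le> 1}"

definition mat_sup_norm :: "real Matrix.mat \<Rightarrow> real" where
  "mat_sup_norm A = Max {\<bar>A $$ (i, j)\<bar> | i j. i < dim_row A \<and> j < dim_col A}"

definition degree_mat :: "real Matrix.mat \<Rightarrow> real Matrix.mat" where
  "degree_mat A = Matrix.mat (dim_col A) (dim_col A)
     (\<lambda>(i, j). if i = j then \<Sum>r<dim_row A. A $$ (r, j) else 0)"

definition laplacian :: "real Matrix.mat \<Rightarrow> real Matrix.mat" where
  "laplacian A = degree_mat A - A"

text \<open>\<open>cond_sim n X \<tau> i j\<close> is $p_{j|i}$: the first index is the one conditioned on.\<close>

definition cond_sim :: "nat \<Rightarrow> (nat \<Rightarrow> real Matrix.vec) \<Rightarrow> (nat \<Rightarrow> real) \<Rightarrow> nat \<Rightarrow> nat \<Rightarrow> real" where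
  "cond_sim n X \<tau> i j =
     exp (- (vec_l2_norm (X i - X j))\<^sup>2 / (2 * (\<tau> i)\<^sup>2)) /
     (\<Sum>l\<in>{..<n} - {i}. exp (- (vec_l2_norm (X i - X l))\<^sup>2 / (2 * (\<tau> i)\<^sup>2)))"

definition sim_mat :: "nat \<Rightarrow> (nat \<Rightarrow> real Matrix.vec) \<Rightarrow> (nat \<Rightarrow> real) \<Rightarrow> real Matrix.mat" where
  "sim_mat n X \<tau> = Matrix.mat n n (\<lambda>(i, j).
     if i = j then 0 else (cond_sim n X \<tau> j i + cond_sim n X \<tau> i j) / (2 * real n))"

definition low_dim_sim :: "nat \<Rightarrow> (nat \<Rightarrow> real ^ 2) \<Rightarrow> nat \<Rightarrow> nat \<Rightarrow> real" where
  "low_dim_sim n y i j =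
     inverse (1 + (norm (y i - y j))\<^sup>2) /
     (\<Sum>(l, s)\<in>{(l, s). l < n \<and> s < n \<and> l \<noteq> s}. inverse (1 + (norm (y l - y s))\<^sup>2))"

definition S_mat :: "nat \<Rightarrow> real Matrix.mat \<Rightarrow> real \<Rightarrow> (nat \<Rightarrow> real ^ 2) \<Rightarrow> real Matrix.mat" where
  "S_mat n P \<alpha> y = Matrix.mat n n (\<lambda>(i, j).
     if i = j then 0
     else (\<alpha> * P $$ (i, j) - low_dim_sim n y i j) / (1 + (norm (y i - y j))\<^sup>2))"

primrec ee_iter :: "nat \<Rightarrow> real Matrix.mat \<Rightarrow> real \<Rightarrow> real \<Rightarrow> (nat \<Rightarrow> real ^ 2) \<Rightarrow> nat \<Rightarrow> nat \<Rightarrow> real ^ 2"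
  where
    "ee_iter n P \<alpha> h y0 0 = y0"
  | "ee_iter n P \<alpha> h y0 (Suc k) =
       (let y = ee_iter n P \<alpha> h y0 k in
        (\<lambda>i. y i + h *\<^sub>R (\<Sum>j\<in>{..<n} - {i}. S_mat n P \<alpha> y $$ (i, j) *\<^sub>R (y j - y i))))"

definition coord_vec :: "nat \<Rightarrow> (nat \<Rightarrow> real ^ 2) \<Rightarrow> 2 \<Rightarrow> real Matrix.vec" where
  "coord_vec n y l = Matrix.vec n (\<lambda>i. vec_nth (y i) l)"

definition max_coord_norm :: "nat \<Rightarrow> (nat \<Rightarrow> real ^ 2) \<Rightarrow> real" where
  "max_coord_norm n y = (MAX l::2. vec_sup_norm (coord_vec n y l))"

definition H_mat :: "nat \<Rightarrow> real Matrix.mat" where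
  "H_mat n = (1 / (real n * (real n - 1))) \<cdot>\<^sub>m (Matrix.mat n n (\<lambda>_. 1) - 1\<^sub>m n)"

end

theory Submission
  imports Defs
begin

text \<open>As \<open>spectral_norm P \<le> n * mat_sup_norm P\<close>, hypothesis (ii) forces the
  initial configuration to shrink to a point. On a configuration of norm at most \<open>1 / 4\<close> all
  entries of \<open>S_mat\<close> are at most \<open>c = \<alpha> * mat_sup_norm P + 4 / n\<^sup>2\<close>, so one step
  multiplies the radius by at most \<open>1 + 2 * h * n * c\<close>; by (iii) the product of \<open>k + 1\<close> such
  factors stays below 2 and even tends to 1. Hence \<open>S_mat\<close> and \<open>\<alpha> P - H\<close> differ
  entrywise by \<open>O(M\<^sup>2 \<alpha> mat_sup_norm P + 1 / n\<^sup>2)\<close>, where \<open>M\<close> is the initial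
  radius, and this is negligible by (ii) and (iii). For the last claim there is nothing to compare:
  both the iterate and its linearisation are still at distance \<open>o(1)\<close> times the norm of the
  starting vector from the starting vector itself.\<close>

section \<open>The Euclidean norm of vectors, reduced to \<open>L2_set\<close>\<close>

lemma vec_l2_norm_eq_L2_set: "vec_l2_norm v = L2_set (vec_index v) {..<dim_vec v}"
  by (simp add: vec_l2_norm_def L2_set_def scalar_prod_def power2_eq_square atLeast0LessThan)

lemma vec_l2_norm_nonneg [simp]: "0 \<le> vec_l2_norm v"
  by (simp add: vec_l2_norm_eq_L2_set)

lemma vec_l2_norm_zero [simp]: "vec_l2_norm (0\<^sub>v n) = 0"
  by (simp add: vec_l2_norm_def)

lemma vec_l2_norm_mono:
  assumes "dim_vec u = dim_vec v"
    and "\<And>i. i < dim_vec v \<Longrightarrow> \<bar>vec_index u i\<bar> \<le> \<bar>vec_index v i\<bar>"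
  shows "vec_l2_norm u \<le> vec_l2_norm v"
proof -
  have "L2_set (\<lambda>i. \<bar>vec_index u i\<bar>) {..<dim_vec v} \<le> L2_set (\<lambda>i. \<bar>vec_index v i\<bar>) {..<dim_vec v}"
    using assms by (intro L2_set_mono) auto
  then show ?thesis
    using assms(1) by (simp add: vec_l2_norm_eq_L2_set L2_set_def)
qed

lemma vec_l2_norm_smult: "vec_l2_norm (c \<cdot>\<^sub>v v) = \<bar>c\<bar> * vec_l2_norm v"
proof -
  have "vec_l2_norm (c \<cdot>\<^sub>v v) = L2_set (\<lambda>i. c * vec_index v i) {..<dim_vec v}"
    unfolding vec_l2_norm_eq_L2_set by (intro L2_set_cong) auto
  also have "\<dots> = \<bar>c\<bar> * vec_l2_norm v"
    by (simp add: vec_l2_norm_eq_L2_set L2_set_def power_mult_distrib real_sqrt_mult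
        flip: sum_distrib_left)
  finally show ?thesis .
qed

lemma vec_l2_norm_add_le:
  assumes "dim_vec u = dim_vec v"
  shows "vec_l2_norm (u + v) \<le> vec_l2_norm u + vec_l2_norm v"
proof -
  have "vec_l2_norm (u + v) = L2_set (\<lambda>i. vec_index u i + vec_index v i) {..<dim_vec v}"
    unfolding vec_l2_norm_eq_L2_set by (intro L2_set_cong) (auto simp: assms)
  also have "\<dots> \<le> L2_set (vec_index u) {..<dim_vec v} + L2_set (vec_index v) {..<dim_vec v}"
    by (rule L2_set_triangle_ineq)
  finally show ?thesis
    by (simp add: vec_l2_norm_eq_L2_set assms)
qed

lemma vec_l2_norm_minus_le:
  assumes "dim_vec u = dim_vec v"
  shows "vec_l2_norm (u - v) \<le> vec_l2_norm u + vec_l2_norm v"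
proof -
  have "u - v = u + (-1) \<cdot>\<^sub>v v"
    by (rule eq_vecI) (auto simp: assms)
  then show ?thesis
    using vec_l2_norm_add_le[of u "(-1) \<cdot>\<^sub>v v"] assms by (simp add: vec_l2_norm_smult)
qed

text \<open>Cauchy-Schwarz on each row bounds every coordinate of the product by
  \<open>c * sqrt n\<close> times the norm of \<open>v\<close>; the \<open>n\<close> coordinates
  together cost a second factor \<open>sqrt n\<close>.\<close>

lemma vec_l2_norm_mult_mat_vec_le:
  assumes A: "A \<in> carrier_mat n n" and v: "v \<in> carrier_vec n"
    and bound: "\<And>i j. i < n \<Longrightarrow> j < n \<Longrightarrow> \<bar>A $$ (i, j)\<bar> \<le> c"
  shows "vec_l2_norm (A *\<^sub>v v) \<le> real n * c * vec_l2_norm v"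
proof (cases "n = 0")
  case True
  then show ?thesis
    using A by (simp add: vec_l2_norm_eq_L2_set)
next
  case False
  then have c: "0 \<le> c"
    using bound[of 0 0] by linarith
  define b where "b = c * (sqrt n * vec_l2_norm v)"
  have b: "0 \<le> b"
    by (simp add: b_def c)
  have entry: "\<bar>vec_index (A *\<^sub>v v) i\<bar> \<le> b" if i: "i < n" for i
  proof -
    have "vec_index (A *\<^sub>v v) i = (\<Sum>j<n. A $$ (i, j) * vec_index v j)"
      using A v i by (simp add: scalar_prod_def atLeast0LessThan)
    also have "\<bar>\<dots>\<bar> \<le> (\<Sum>j<n. \<bar>A $$ (i, j)\<bar> * \<bar>vec_index v j\<bar>)"
      using sum_abs[of "\<lambda>j. A $$ (i, j) * vec_index v j" "{..<n}"] by (simp add: abs_mult)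
    \<comment> \<open>The factor \<open>\<bar>1\<bar>\<close> gives the sum the shape of
      \<open>L2_set_mult_ineq\<close>, with the constant function 1 as the other vector.\<close>
    also have "\<dots> \<le> (\<Sum>j<n. c * (\<bar>1\<bar> * \<bar>vec_index v j\<bar>))"
      using bound i by (intro sum_mono) (auto intro: mult_right_mono)
    also have "\<dots> = c * (\<Sum>j<n. \<bar>1\<bar> * \<bar>vec_index v j\<bar>)"
      by (simp add: sum_distrib_left)
    also have "\<dots> \<le> c * (L2_set (\<lambda>_. 1) {..<n} * L2_set (vec_index v) {..<n})"
      by (intro mult_left_mono L2_set_mult_ineq c)
    also have "\<dots> = b"
      using v by (simp add: b_def vec_l2_norm_eq_L2_set L2_set_def)
    finally show ?thesis .
  qed
  have "vec_l2_norm (A *\<^sub>v v) \<le> vec_l2_norm (Matrix.vec n (\<lambda>_. b))"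
    using A entry b by (intro vec_l2_norm_mono) auto
  also have "\<dots> = sqrt n * b"
    using b by (simp add: vec_l2_norm_eq_L2_set L2_set_def real_sqrt_mult)
  also have "\<dots> = real n * c * vec_l2_norm v"
    by (simp add: b_def)
  finally show ?thesis .
qed

section \<open>The spectral norm and entrywise bounds for it\<close>

lemma spectral_norm_le:
  assumes "\<And>v. v \<in> carrier_vec (dim_col A) \<Longrightarrow> vec_l2_norm v \<le> 1 \<Longrightarrow> vec_l2_norm (A *\<^sub>v v) \<le> b"
  shows "spectral_norm A \<le> b"
  unfolding spectral_norm_def
proof (rule cSup_least)
  have "0\<^sub>v (dim_col A) \<in> carrier_vec (dim_col A) \<and> vec_l2_norm (0\<^sub>v (dim_col A)) \<le> 1"
    by simp
  then show "{vec_l2_norm (A *\<^sub>v v) | v. v \<in> carrier_vec (dim_col A) \<and> vec_l2_norm v \<le> 1} \<noteq> {}"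
    by blast
qed (use assms in auto)

lemma spectral_norm_le_of_entries:
  assumes "A \<in> carrier_mat n n" and "0 \<le> c"
    and "\<And>i j. i < n \<Longrightarrow> j < n \<Longrightarrow> \<bar>A $$ (i, j)\<bar> \<le> c"
  shows "spectral_norm A \<le> real n * c"
proof (rule spectral_norm_le)
  fix v assume "v \<in> carrier_vec (dim_col A)" "vec_l2_norm v \<le> 1"
  then have "vec_l2_norm (A *\<^sub>v v) \<le> real n * c * vec_l2_norm v"
    using assms by (intro vec_l2_norm_mult_mat_vec_le) auto
  also have "\<dots> \<le> real n * c * 1"
    using assms \<open>vec_l2_norm v \<le> 1\<close> by (intro mult_left_mono) auto
  finally show "vec_l2_norm (A *\<^sub>v v) \<le> real n * c" by simp
qed

lemma abs_entry_le_mat_sup_norm: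
  assumes "i < dim_row A" "j < dim_col A"
  shows "\<bar>A $$ (i, j)\<bar> \<le> mat_sup_norm A"
proof -
  have "{\<bar>A $$ (i, j)\<bar> | i j. i < dim_row A \<and> j < dim_col A}
      = (\<lambda>(i, j). \<bar>A $$ (i, j)\<bar>) ` ({..<dim_row A} \<times> {..<dim_col A})"
    by auto
  then have "finite {\<bar>A $$ (i, j)\<bar> | i j. i < dim_row A \<and> j < dim_col A}"
    by simp
  then show ?thesis
    unfolding mat_sup_norm_def using assms by (intro Max_ge) auto
qed

text \<open>\<open>Sup\<close> over the reals is an upper bound only of a set that is bounded above,
  and the entrywise estimate supplies this. The absolute value of \<open>mat_sup_norm A\<close> is
  there for \<open>n = 0\<close>, where the maximum of the empty set has no known sign.\<close>

lemma vec_l2_norm_mult_le_spectral_norm: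
  assumes A: "A \<in> carrier_mat n n" and v: "v \<in> carrier_vec n" "vec_l2_norm v \<le> 1"
  shows "vec_l2_norm (A *\<^sub>v v) \<le> spectral_norm A"
proof -
  have "vec_l2_norm (A *\<^sub>v u) \<le> real n * \<bar>mat_sup_norm A\<bar> * 1"
    if "u \<in> carrier_vec n" "vec_l2_norm u \<le> 1" for u
  proof -
    have "vec_l2_norm (A *\<^sub>v u) \<le> real n * \<bar>mat_sup_norm A\<bar> * vec_l2_norm u"
      using A that abs_entry_le_mat_sup_norm[of _ A]
      by (intro vec_l2_norm_mult_mat_vec_le) (auto intro: order_trans[OF _ abs_ge_self])
    also have "\<dots> \<le> real n * \<bar>mat_sup_norm A\<bar> * 1"
      using that by (intro mult_left_mono) auto
    finally show ?thesis .
  qed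
  then have "bdd_above {vec_l2_norm (A *\<^sub>v v) | v. v \<in> carrier_vec (dim_col A) \<and> vec_l2_norm v \<le> 1}"
    using A by (intro bdd_aboveI[of _ "real n * \<bar>mat_sup_norm A\<bar> * 1"]) auto
  then show ?thesis
    unfolding spectral_norm_def using A v by (intro cSup_upper) auto
qed

lemma spectral_norm_nonneg:
  assumes "A \<in> carrier_mat n n"
  shows "0 \<le> spectral_norm A"
proof -
  have "vec_l2_norm (A *\<^sub>v 0\<^sub>v n) \<le> spectral_norm A"
    using assms by (intro vec_l2_norm_mult_le_spectral_norm) auto
  then show ?thesis
    using vec_l2_norm_nonneg[of "A *\<^sub>v 0\<^sub>v n"] by linarith
qed

text \<open>The triangle inequality for \<open>a A = (a A - B) + B\<close>, tested on vectors of the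
  unit ball. It serves to bound the denominator of the first limit from below.\<close>

lemma spectral_norm_smult_le:
  assumes A: "A \<in> carrier_mat n n" and B: "B \<in> carrier_mat n n" and a: "0 < a"
  shows "a * spectral_norm A \<le> spectral_norm (a \<cdot>\<^sub>m A - B) + spectral_norm B"
proof -
  have "spectral_norm A \<le> (spectral_norm (a \<cdot>\<^sub>m A - B) + spectral_norm B) / a"
  proof (rule spectral_norm_le)
    fix v assume "v \<in> carrier_vec (dim_col A)" and v1: "vec_l2_norm v \<le> 1"
    then have v: "v \<in> carrier_vec n"
      using A by simp
    have "a \<cdot>\<^sub>v (A *\<^sub>v v) = (a \<cdot>\<^sub>m A - B) *\<^sub>v v + B *\<^sub>v v"
      using A B v
      by (intro eq_vecI)
        (auto simp: scalar_prod_def algebra_simps sum_distrib_left simp flip: sum.distrib)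
    then have "a * vec_l2_norm (A *\<^sub>v v) = vec_l2_norm ((a \<cdot>\<^sub>m A - B) *\<^sub>v v + B *\<^sub>v v)"
      using a by (metis abs_of_pos vec_l2_norm_smult)
    also have "\<dots> \<le> vec_l2_norm ((a \<cdot>\<^sub>m A - B) *\<^sub>v v) + vec_l2_norm (B *\<^sub>v v)"
      using A B by (intro vec_l2_norm_add_le) auto
    also have "\<dots> \<le> spectral_norm (a \<cdot>\<^sub>m A - B) + spectral_norm B"
      using A B v v1 by (intro add_mono vec_l2_norm_mult_le_spectral_norm) auto
    finally show "vec_l2_norm (A *\<^sub>v v) \<le> (spectral_norm (a \<cdot>\<^sub>m A - B) + spectral_norm B) / a"
      using a by (simp add: field_simps)
  qed
  then show ?thesis
    using a by (simp add: field_simps)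
qed

section \<open>Laplacians and iterated steps \<open>I - h L\<close>\<close>

lemma laplacian_carrier [simp]: "A \<in> carrier_mat n n \<Longrightarrow> laplacian A \<in> carrier_mat n n"
  by (simp add: laplacian_def minus_carrier_mat)

lemma laplacian_mult_vec_index:
  assumes A: "A \<in> carrier_mat n n" and v: "v \<in> carrier_vec n" and i: "i < n"
  shows "vec_index (laplacian A *\<^sub>v v) i
    = (\<Sum>r<n. A $$ (r, i)) * vec_index v i - vec_index (A *\<^sub>v v) i"
proof -
  have "vec_index (laplacian A *\<^sub>v v) i
      = (\<Sum>j<n. ((if i = j then \<Sum>r<n. A $$ (r, j) else 0) - A $$ (i, j)) * vec_index v j)"
    using carrier_matD[OF A] v i
    by (simp add: laplacian_def degree_mat_def scalar_prod_def atLeast0LessThan cong: if_cong)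
  also have "\<dots> = (\<Sum>j<n. if i = j then (\<Sum>r<n. A $$ (r, j)) * vec_index v j else 0)
      - (\<Sum>j<n. A $$ (i, j) * vec_index v j)"
    unfolding sum_subtractf[symmetric] by (intro sum.cong) (auto simp: algebra_simps)
  also have "\<dots> = (\<Sum>r<n. A $$ (r, i)) * vec_index v i - vec_index (A *\<^sub>v v) i"
    using A v i by (simp add: scalar_prod_def atLeast0LessThan)
  finally show ?thesis .
qed

text \<open>The degree part is diagonal, with column sums of modulus at most \<open>n * c\<close>,
  and \<open>A\<close> itself has norm at most \<open>n * c\<close>; hence the factor 2.\<close>

lemma vec_l2_norm_laplacian_le:
  assumes A: "A \<in> carrier_mat n n" and v: "v \<in> carrier_vec n"
    and bound: "\<And>i j. i < n \<Longrightarrow> j < n \<Longrightarrow> \<bar>A $$ (i, j)\<bar> \<le> c"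
  shows "vec_l2_norm (laplacian A *\<^sub>v v) \<le> 2 * (real n * c) * vec_l2_norm v"
proof -
  define u where "u = Matrix.vec n (\<lambda>i. (\<Sum>r<n. A $$ (r, i)) * vec_index v i)"
  have "laplacian A *\<^sub>v v = u - A *\<^sub>v v"
    using A carrier_matD[OF laplacian_carrier[OF A]]
    by (intro eq_vecI) (auto simp: laplacian_mult_vec_index[OF A v] u_def simp del: index_mult_mat_vec)
  then have "vec_l2_norm (laplacian A *\<^sub>v v) \<le> vec_l2_norm u + vec_l2_norm (A *\<^sub>v v)"
    using A by (simp add: vec_l2_norm_minus_le u_def)
  moreover have "vec_l2_norm u \<le> real n * c * vec_l2_norm v"
  proof -
    have col: "\<bar>\<Sum>r<n. A $$ (r, i)\<bar> \<le> \<bar>real n * c\<bar>" if "i < n" for i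
    proof -
      have "\<bar>\<Sum>r<n. A $$ (r, i)\<bar> \<le> (\<Sum>r<n. c)"
        using bound that by (intro order_trans[OF sum_abs] sum_mono) auto
      then show ?thesis by simp
    qed
    have "vec_l2_norm u \<le> vec_l2_norm ((real n * c) \<cdot>\<^sub>v v)"
      using v col by (intro vec_l2_norm_mono) (auto simp: u_def abs_mult intro!: mult_right_mono)
    moreover have "0 \<le> real n * c"
      using bound[of 0 0] by (cases "n = 0") auto
    ultimately show ?thesis
      by (simp add: vec_l2_norm_smult)
  qed
  moreover have "vec_l2_norm (A *\<^sub>v v) \<le> real n * c * vec_l2_norm v"
    by (rule vec_l2_norm_mult_mat_vec_le[OF A v bound])
  ultimately show ?thesis by linarith
qed

text \<open>With \<open>b = 2 * h * n * c\<close>, step \<open>m\<close> moves the vector by at most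
  \<open>b\<close> times its norm, which is at most \<open>(1 + b) ^ m\<close> times the initial
  norm; these displacements form a geometric sum. The matrix may change from step to step, so that
  the nonlinear iteration and its linearisation are both covered.\<close>

lemma vec_l2_norm_laplacian_iterate_le:
  fixes w :: "nat \<Rightarrow> real Matrix.vec"
  assumes h: "0 \<le> h" and c: "0 \<le> c" and w: "\<And>j. w j \<in> carrier_vec n"
    and A: "\<And>j. A j \<in> carrier_mat n n"
    and bound: "\<And>m i j. m < k \<Longrightarrow> i < n \<Longrightarrow> j < n \<Longrightarrow> \<bar>A m $$ (i, j)\<bar> \<le> c"
    and step: "\<And>j. j < k \<Longrightarrow> w (Suc j) = w j - h \<cdot>\<^sub>v (laplacian (A j) *\<^sub>v w j)"
  shows "vec_l2_norm (w k - w 0) \<le> ((1 + 2 * (h * (real n * c))) ^ k - 1) * vec_l2_norm (w 0)"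
proof -
  define b where "b = 2 * (h * (real n * c))"
  have b: "0 \<le> b" using h c by (simp add: b_def)
  have "vec_l2_norm (w m - w 0) \<le> ((1 + b) ^ m - 1) * vec_l2_norm (w 0)" if "m \<le> k" for m
    using that
  proof (induction m)
    case 0
    have "w 0 - w 0 = 0\<^sub>v n" using w[of 0] by simp
    then show ?case by simp
  next
    case (Suc m)
    have dims: "dim_vec (w j) = n" for j using w[of j] by simp
    have dimL: "dim_row (laplacian (A m)) = n" using laplacian_carrier[OF A[of m]] by simp
    have IH: "vec_l2_norm (w m - w 0) \<le> ((1 + b) ^ m - 1) * vec_l2_norm (w 0)"
      using Suc by simp
    \<comment> \<open>By the triangle inequality the bound on the displacement also bounds
      \<open>w m\<close> itself, so a single induction suffices.\<close>
    have "w m = (w m - w 0) + w 0"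
      by (intro eq_vecI) (auto simp: dims)
    then have "vec_l2_norm (w m) \<le> vec_l2_norm (w m - w 0) + vec_l2_norm (w 0)"
      using vec_l2_norm_add_le[of "w m - w 0" "w 0"] dims by simp
    then have wm: "vec_l2_norm (w m) \<le> (1 + b) ^ m * vec_l2_norm (w 0)"
      using IH by (simp add: algebra_simps)
    have "w (Suc m) - w 0 = (w m - w 0) - h \<cdot>\<^sub>v (laplacian (A m) *\<^sub>v w m)"
      using step[of m] Suc.prems by (intro eq_vecI) (auto simp: dims dimL)
    then have "vec_l2_norm (w (Suc m) - w 0)
        \<le> vec_l2_norm (w m - w 0) + vec_l2_norm (h \<cdot>\<^sub>v (laplacian (A m) *\<^sub>v w m))"
      using vec_l2_norm_minus_le[of "w m - w 0" "h \<cdot>\<^sub>v (laplacian (A m) *\<^sub>v w m)"] dims dimL by simp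
    also have "\<dots> \<le> vec_l2_norm (w m - w 0) + h * (2 * (real n * c) * vec_l2_norm (w m))"
      unfolding vec_l2_norm_smult
      using h Suc.prems bound
      by (intro add_left_mono mult_mono vec_l2_norm_laplacian_le[OF A w]) auto
    also have "\<dots> = vec_l2_norm (w m - w 0) + b * vec_l2_norm (w m)"
      by (simp add: b_def)
    also have "\<dots> \<le> ((1 + b) ^ m - 1) * vec_l2_norm (w 0) + b * ((1 + b) ^ m * vec_l2_norm (w 0))"
      using IH wm b by (intro add_mono mult_left_mono) auto
    also have "\<dots> = ((1 + b) ^ Suc m - 1) * vec_l2_norm (w 0)"
      by (simp add: algebra_simps)
    finally show ?case .
  qed
  then show ?thesis by (simp add: b_def)
qed

text \<open>The successive powers applied to \<open>v\<close> are the iteration of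
  \<open>vec_l2_norm_laplacian_iterate_le\<close> with a constant matrix.\<close>

lemma vec_l2_norm_pow_mat_laplacian_le:
  assumes h: "0 \<le> h" and c: "0 \<le> c" and v: "v \<in> carrier_vec n" and A: "A \<in> carrier_mat n n"
    and bound: "\<And>i j. i < n \<Longrightarrow> j < n \<Longrightarrow> \<bar>A $$ (i, j)\<bar> \<le> c"
  shows "vec_l2_norm ((1\<^sub>m n - h \<cdot>\<^sub>m laplacian A) ^\<^sub>m k *\<^sub>v v - v)
    \<le> ((1 + 2 * (h * (real n * c))) ^ k - 1) * vec_l2_norm v"
proof -
  define B where "B = 1\<^sub>m n - h \<cdot>\<^sub>m laplacian A"
  have B: "B \<in> carrier_mat n n" using A by (simp add: B_def minus_carrier_mat)
  \<comment> \<open>The power \<open>^\<^sub>m\<close> appends its new factor on the right, whereas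
    the iteration applies it on the left.\<close>
  have comm: "B ^\<^sub>m j * B = B * B ^\<^sub>m j" for j
  proof (induction j)
    case (Suc j)
    have "B ^\<^sub>m Suc j * B = B * B ^\<^sub>m j * B" using Suc by simp
    also have "\<dots> = B * (B ^\<^sub>m j * B)" using B by (intro assoc_mult_mat) auto
    finally show ?case by simp
  qed (use B in simp)
  have Bu: "B *\<^sub>v u = u - h \<cdot>\<^sub>v (laplacian A *\<^sub>v u)" if u: "u \<in> carrier_vec n" for u
  proof -
    have "B *\<^sub>v u = 1\<^sub>m n *\<^sub>v u - (h \<cdot>\<^sub>m laplacian A) *\<^sub>v u"
      unfolding B_def using A u by (intro minus_mult_distrib_mat_vec) auto
    moreover have "(h \<cdot>\<^sub>m laplacian A) *\<^sub>v u = h \<cdot>\<^sub>v (laplacian A *\<^sub>v u)"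
      using laplacian_carrier[OF A] u by (intro eq_vecI) (auto simp: scalar_prod_def sum_distrib_left mult.assoc)
    ultimately show ?thesis using u by simp
  qed
  have Bj: "B ^\<^sub>m j \<in> carrier_mat n n" for j using B by simp
  have "B ^\<^sub>m Suc j *\<^sub>v v = B ^\<^sub>m j *\<^sub>v v - h \<cdot>\<^sub>v (laplacian A *\<^sub>v (B ^\<^sub>m j *\<^sub>v v))" for j
  proof -
    have "B ^\<^sub>m Suc j *\<^sub>v v = B *\<^sub>v (B ^\<^sub>m j *\<^sub>v v)"
      using assoc_mult_mat_vec[OF B Bj v, of j] comm[of j] by simp
    also have "\<dots> = B ^\<^sub>m j *\<^sub>v v - h \<cdot>\<^sub>v (laplacian A *\<^sub>v (B ^\<^sub>m j *\<^sub>v v))"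
      using Bj[of j] v by (intro Bu) auto
    finally show ?thesis .
  qed
  moreover have "B ^\<^sub>m j *\<^sub>v v \<in> carrier_vec n" for j
    using Bj[of j] v by (rule mult_mat_vec_carrier)
  ultimately have "vec_l2_norm (B ^\<^sub>m k *\<^sub>v v - B ^\<^sub>m 0 *\<^sub>v v)
      \<le> ((1 + 2 * (h * (real n * c))) ^ k - 1) * vec_l2_norm (B ^\<^sub>m 0 *\<^sub>v v)"
    by (intro vec_l2_norm_laplacian_iterate_le[where A = "\<lambda>_. A" and w = "\<lambda>j. B ^\<^sub>m j *\<^sub>v v" and n = n])
      (use h c A bound in auto)
  then show ?thesis
    using v B by (simp flip: B_def)
qed

section \<open>Configurations in the plane and their low-dimensional similarities\<close>

lemma max_coord_norm_bounds:
  assumes "i < n"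
  shows "0 \<le> max_coord_norm n y" and "norm (y i) \<le> 2 * max_coord_norm n y"
proof -
  have *: "\<bar>vec_nth (y i) l\<bar> \<le> max_coord_norm n y" for l
  proof -
    have "\<bar>vec_nth (y i) l\<bar> \<le> vec_sup_norm (coord_vec n y l)"
    proof -
      have "{\<bar>vec_index (coord_vec n y l) i\<bar> | i. i < dim_vec (coord_vec n y l)}
          = (\<lambda>i. \<bar>vec_nth (y i) l\<bar>) ` {..<n}"
        by (force simp: coord_vec_def)
      then show ?thesis
        unfolding vec_sup_norm_def using assms by (auto intro!: Max_ge)
    qed
    also have "\<dots> \<le> max_coord_norm n y"
      unfolding max_coord_norm_def by (intro Max_ge) auto
    finally show ?thesis .
  qed
  show "0 \<le> max_coord_norm n y"
    using *[of 1] by linarith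
  \<comment> \<open>The Euclidean norm is at most the sum of the moduli of the two coordinates;
    hence the factor 2.\<close>
  have "norm (y i) \<le> (\<Sum>l\<in>UNIV. \<bar>vec_nth (y i) l\<bar>)"
    by (rule norm_le_l1_cart)
  also have "\<dots> \<le> (\<Sum>l\<in>(UNIV :: 2 set). max_coord_norm n y)"
    by (intro sum_mono *)
  finally show "norm (y i) \<le> 2 * max_coord_norm n y"
    by simp
qed

lemma card_off_diagonal: "card {(l, s). l < n \<and> s < n \<and> l \<noteq> s} = n * n - n"
proof -
  have "{(l, s). l < n \<and> s < n \<and> l \<noteq> s} = {..<n} \<times> {..<n} - (\<lambda>i. (i, i)) ` {..<n}"
    by auto
  moreover have "card ((\<lambda>i. (i, i)) ` {..<n}) = n"
    by (subst card_image) (auto intro: inj_onI)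
  moreover have "(\<lambda>i. (i, i)) ` {..<n} \<subseteq> {..<n} \<times> {..<n}"
    by auto
  ultimately show ?thesis
    by (simp add: card_Diff_subset)
qed

lemma low_dim_sim_commute: "low_dim_sim n y i j = low_dim_sim n y j i"
  by (simp add: low_dim_sim_def norm_minus_commute)

lemma square_norm_diff_le:
  fixes a b :: "'a :: real_normed_vector"
  assumes "norm a \<le> R" "norm b \<le> R"
  shows "(norm (a - b))\<^sup>2 \<le> 4 * R\<^sup>2"
proof -
  have "norm (a - b) \<le> 2 * R"
    using norm_triangle_ineq4[of a b] assms by linarith
  then have "(norm (a - b))\<^sup>2 \<le> (2 * R)\<^sup>2"
    by (intro power_mono) auto
  then show ?thesis by (simp add: power_mult_distrib)
qed

text \<open>This is \<open>n - 1 \<ge> n / 2\<close>. It brings the entries of \<open>H_mat\<close>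
  and the low-dimensional similarities to the common scale \<open>1 / n\<^sup>2\<close>.\<close>

lemma one_over_offdiag_le:
  assumes "2 \<le> n"
  shows "1 / (real n * (real n - 1)) \<le> 2 / (real n)\<^sup>2"
  using assms by (simp add: field_simps power2_eq_square)

text \<open>Points of norm at most \<open>1 / 4\<close> are close enough that each of the
  \<open>n * (n - 1)\<close> terms of the normalising sum is at least \<open>1 / 2\<close>, while
  the numerator never exceeds 1. The indices \<open>i\<close> and \<open>j\<close> are unrestricted
  because they enter only the numerator.\<close>

lemma low_dim_sim_bounds:
  assumes n: "2 \<le> n" and y: "\<And>i. i < n \<Longrightarrow> norm (y i) \<le> 1 / 4"
  shows "0 \<le> low_dim_sim n y i j" and "low_dim_sim n y i j \<le> 4 / (real n)\<^sup>2"
proof -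
  define I where "I = {(l, s). l < n \<and> s < n \<and> l \<noteq> s}"
  define Z where "Z = (\<Sum>(l, s)\<in>I. inverse (1 + (norm (y l - y s))\<^sup>2))"
  have cardI: "real (card I) = real n * (real n - 1)"
    using n by (simp add: I_def card_off_diagonal of_nat_diff algebra_simps)
  have "(\<Sum>(l, s)\<in>I. 1 / 2) \<le> Z"
    unfolding Z_def
  proof (intro sum_mono, clarify)
    fix l s assume "(l, s) \<in> I"
    then have "(norm (y l - y s))\<^sup>2 \<le> 4 * (1 / 4)\<^sup>2"
      by (intro square_norm_diff_le y) (auto simp: I_def)
    then have "1 + (norm (y l - y s))\<^sup>2 \<le> 2"
      by (simp add: power2_eq_square)
    moreover have "0 < 1 + (norm (y l - y s))\<^sup>2"
      by (simp add: add_pos_nonneg)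
    ultimately show "1 / 2 \<le> inverse (1 + (norm (y l - y s))\<^sup>2)"
      by (simp add: field_simps)
  qed
  then have Z: "real n * (real n - 1) / 2 \<le> Z"
    using cardI by (simp add: case_prod_unfold)
  have pos: "0 < real n * (real n - 1) / 2"
    using n by simp
  have eq: "low_dim_sim n y i j = inverse (1 + (norm (y i - y j))\<^sup>2) / Z"
    by (simp add: low_dim_sim_def Z_def I_def)
  show "0 \<le> low_dim_sim n y i j"
    unfolding eq using Z pos by (intro divide_nonneg_nonneg) auto
  have "inverse (1 + (norm (y i - y j))\<^sup>2) / Z \<le> 1 / (real n * (real n - 1) / 2)"
    using Z pos by (intro frac_le) (auto simp: inverse_le_1_iff)
  also have "\<dots> = 2 * (1 / (real n * (real n - 1)))"
    by simp
  also have "\<dots> \<le> 2 * (2 / (real n)\<^sup>2)"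
    by (intro mult_left_mono one_over_offdiag_le n) auto
  finally show "low_dim_sim n y i j \<le> 4 / (real n)\<^sup>2"
    unfolding eq by simp
qed

section \<open>One step of the iteration as a Laplacian step\<close>

lemma S_mat_carrier [simp]: "S_mat n P \<alpha> y \<in> carrier_mat n n"
  by (simp add: S_mat_def)

lemma H_mat_carrier [simp]: "H_mat n \<in> carrier_mat n n"
  by (simp add: H_mat_def minus_carrier_mat)

lemma H_mat_index:
  assumes "i < n" "j < n"
  shows "H_mat n $$ (i, j) = (if i = j then 0 else 1 / (real n * (real n - 1)))"
  using assms by (simp add: H_mat_def)

text \<open>Symmetry of \<open>P\<close> passes to \<open>S_mat\<close>, so the row sums occurring
  in the update agree with the column sums in \<open>degree_mat\<close>. The two coordinates are
  coupled only through the matrix \<open>S_mat\<close>.\<close>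

lemma coord_vec_ee_iter_Suc:
  assumes sym: "\<And>i j. i < n \<Longrightarrow> j < n \<Longrightarrow> P $$ (i, j) = P $$ (j, i)"
  shows "coord_vec n (ee_iter n P \<alpha> h y0 (Suc m)) l =
    coord_vec n (ee_iter n P \<alpha> h y0 m) l -
      h \<cdot>\<^sub>v (laplacian (S_mat n P \<alpha> (ee_iter n P \<alpha> h y0 m)) *\<^sub>v coord_vec n (ee_iter n P \<alpha> h y0 m) l)"
proof -
  define y where "y = ee_iter n P \<alpha> h y0 m"
  define S where "S = S_mat n P \<alpha> y"
  define v where "v = coord_vec n y l"
  have S: "S \<in> carrier_mat n n" by (simp add: S_def)
  have v: "v \<in> carrier_vec n" by (simp add: v_def coord_vec_def)
  have Ssym: "S $$ (i, j) = S $$ (j, i)" if "i < n" "j < n" for i j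
    using that sym[OF that] low_dim_sim_commute[of n y i j]
    by (simp add: S_def S_mat_def norm_minus_commute)
  have "coord_vec n (ee_iter n P \<alpha> h y0 (Suc m)) l = v - h \<cdot>\<^sub>v (laplacian S *\<^sub>v v)"
  proof (rule eq_vecI)
    fix i assume "i < dim_vec (v - h \<cdot>\<^sub>v (laplacian S *\<^sub>v v))"
    then have i: "i < n"
      using laplacian_carrier[OF S] by simp
    have "vec_index (coord_vec n (ee_iter n P \<alpha> h y0 (Suc m)) l) i
        = vec_nth (y i) l + h * (\<Sum>j\<in>{..<n} - {i}. S $$ (i, j) * (vec_nth (y j) l - vec_nth (y i) l))"
      using i by (simp add: coord_vec_def Let_def flip: y_def S_def)
    also have "(\<Sum>j\<in>{..<n} - {i}. S $$ (i, j) * (vec_nth (y j) l - vec_nth (y i) l))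
        = (\<Sum>j<n. S $$ (i, j) * (vec_nth (y j) l - vec_nth (y i) l))"
      by (intro sum.mono_neutral_left) auto
    also have "\<dots> = (\<Sum>j<n. S $$ (i, j) * vec_nth (y j) l) - (\<Sum>j<n. S $$ (i, j)) * vec_nth (y i) l"
      by (simp add: algebra_simps sum_subtractf sum_distrib_left)
    also have "(\<Sum>j<n. S $$ (i, j)) = (\<Sum>r<n. S $$ (r, i))"
      using Ssym i by (intro sum.cong) auto
    also have "(\<Sum>j<n. S $$ (i, j) * vec_nth (y j) l) = vec_index (S *\<^sub>v v) i"
      using S i by (simp add: scalar_prod_def atLeast0LessThan v_def coord_vec_def)
    finally have lhs: "vec_index (coord_vec n (ee_iter n P \<alpha> h y0 (Suc m)) l) i
        = vec_nth (y i) l + h * (vec_index (S *\<^sub>v v) i - (\<Sum>r<n. S $$ (r, i)) * vec_nth (y i) l)" .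
    have "vec_index (v - h \<cdot>\<^sub>v (laplacian S *\<^sub>v v)) i = vec_nth (y i) l - h * vec_index (laplacian S *\<^sub>v v) i"
      using carrier_matD[OF laplacian_carrier[OF S]] i by (simp add: v_def coord_vec_def)
    also have "\<dots> = vec_nth (y i) l - h * ((\<Sum>r<n. S $$ (r, i)) * vec_nth (y i) l - vec_index (S *\<^sub>v v) i)"
      unfolding laplacian_mult_vec_index[OF S v i] using i by (simp add: v_def coord_vec_def)
    finally show "vec_index (coord_vec n (ee_iter n P \<alpha> h y0 (Suc m)) l) i
        = vec_index (v - h \<cdot>\<^sub>v (laplacian S *\<^sub>v v)) i"
      unfolding lhs by (simp add: right_diff_distrib)
  qed (use laplacian_carrier[OF S] in \<open>simp add: coord_vec_def\<close>)
  then show ?thesis by (simp add: y_def S_def v_def)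
qed

section \<open>Estimates for a fixed number of points\<close>

locale small_affinities =
  fixes n :: nat and P :: "real Matrix.mat" and \<alpha> p :: real
  assumes n: "2 \<le> n" and P: "P \<in> carrier_mat n n" and alpha: "0 < \<alpha>"
    and diag: "\<And>i. i < n \<Longrightarrow> P $$ (i, i) = 0"
    and nonneg: "\<And>i j. i < n \<Longrightarrow> j < n \<Longrightarrow> 0 \<le> P $$ (i, j)"
    and le: "\<And>i j. i < n \<Longrightarrow> j < n \<Longrightarrow> P $$ (i, j) \<le> p"
begin

text \<open>One constant for the entries both of \<open>S_mat\<close> at radius at most
  \<open>1 / 4\<close> and of \<open>\<alpha> P - H\<close>, so that the iteration and its
  linearisation obey the same displacement bound. The term \<open>4 / n\<^sup>2\<close> covers
  \<open>low_dim_sim\<close> as well as \<open>H_mat\<close>.\<close>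

definition entry_bound where "entry_bound = \<alpha> * p + 4 / (real n)\<^sup>2"

lemma p_nonneg: "0 \<le> p"
  using nonneg[of 0 0] le[of 0 0] n by simp

lemma alpha_entry: "i < n \<Longrightarrow> j < n \<Longrightarrow> 0 \<le> \<alpha> * P $$ (i, j) \<and> \<alpha> * P $$ (i, j) \<le> \<alpha> * p"
  using nonneg le alpha by simp

lemma entry_bound_nonneg: "0 \<le> entry_bound"
  using p_nonneg alpha by (simp add: entry_bound_def)

text \<open>Division by \<open>1 + d\<close> only shrinks, and the numerator is a difference of two
  nonnegative numbers, at most \<open>\<alpha> * p\<close> and \<open>4 / n\<^sup>2\<close>.\<close>

lemma S_mat_entry_le:
  assumes y: "\<And>i. i < n \<Longrightarrow> norm (y i) \<le> 1 / 4" and ij: "i < n" "j < n"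
  shows "\<bar>S_mat n P \<alpha> y $$ (i, j)\<bar> \<le> entry_bound"
proof (cases "i = j")
  case False
  define d where "d = (norm (y i - y j))\<^sup>2"
  have "\<bar>S_mat n P \<alpha> y $$ (i, j)\<bar> = \<bar>\<alpha> * P $$ (i, j) - low_dim_sim n y i j\<bar> / (1 + d)"
    using False ij by (simp add: S_mat_def d_def abs_of_pos add_pos_nonneg)
  also have "\<dots> \<le> \<bar>\<alpha> * P $$ (i, j) - low_dim_sim n y i j\<bar> / 1"
    by (intro divide_left_mono) (auto simp: d_def add_pos_nonneg)
  also have "\<dots> \<le> entry_bound"
    using alpha_entry[OF ij] low_dim_sim_bounds[where y = y and i = i and j = j, OF n y]
    unfolding entry_bound_def by (simp add: abs_le_iff)
  finally show ?thesis .
qed (use ij entry_bound_nonneg in \<open>simp add: S_mat_def\<close>)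

lemma H_entry_le:
  assumes "i < n" "j < n"
  shows "0 \<le> H_mat n $$ (i, j)" and "H_mat n $$ (i, j) \<le> 2 / (real n)\<^sup>2"
  using assms n one_over_offdiag_le[OF n] by (auto simp: H_mat_index)

lemma limit_entry_le:
  assumes ij: "i < n" "j < n"
  shows "\<bar>(\<alpha> \<cdot>\<^sub>m P - H_mat n) $$ (i, j)\<bar> \<le> entry_bound"
proof -
  have "(\<alpha> \<cdot>\<^sub>m P - H_mat n) $$ (i, j) = \<alpha> * P $$ (i, j) - H_mat n $$ (i, j)"
    using P ij carrier_matD[OF H_mat_carrier] by simp
  moreover have "2 / (real n)\<^sup>2 \<le> 4 / (real n)\<^sup>2"
    by (intro divide_right_mono) auto
  ultimately show ?thesis
    using alpha_entry[OF ij] H_entry_le[OF ij] unfolding entry_bound_def by linarith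
qed

text \<open>Off the diagonal, in the notation of the proof, the entry splits as
  \<open>(H - q / (1 + d)) - a * (d / (1 + d))\<close>. The bracket is a difference of two numbers
  between 0 and \<open>4 / n\<^sup>2\<close>, and the last factor is at most
  \<open>d \<le> 4 * R\<^sup>2\<close>. On the diagonal the entry is 0.\<close>

lemma S_mat_diff_entry_le:
  assumes R: "R \<le> 1 / 4" and y: "\<And>i. i < n \<Longrightarrow> norm (y i) \<le> R" and ij: "i < n" "j < n"
  shows "\<bar>(S_mat n P \<alpha> y - (\<alpha> \<cdot>\<^sub>m P - H_mat n)) $$ (i, j)\<bar> \<le> 4 * R\<^sup>2 * (\<alpha> * p) + 4 / (real n)\<^sup>2"
proof -
  define d where "d = (norm (y i - y j))\<^sup>2"
  define q where "q = low_dim_sim n y i j"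
  define a where "a = \<alpha> * P $$ (i, j)"
  define H where "H = H_mat n $$ (i, j)"
  have d: "0 \<le> d" "d \<le> 4 * R\<^sup>2"
    unfolding d_def using y ij by (auto intro: square_norm_diff_le)
  have y': "norm (y i) \<le> 1 / 4" if "i < n" for i
    using y[OF that] R by linarith
  have q: "0 \<le> q" "q \<le> 4 / (real n)\<^sup>2"
    unfolding q_def using low_dim_sim_bounds[OF n, of y i j] y' by auto
  have a: "0 \<le> a" "a \<le> \<alpha> * p"
    using alpha_entry[OF ij] by (auto simp: a_def)
  have H: "0 \<le> H" "H \<le> 4 / (real n)\<^sup>2"
    using H_entry_le[OF ij] divide_right_mono[of 2 4 "(real n)\<^sup>2"] by (auto simp: H_def)
  have entry: "(S_mat n P \<alpha> y - (\<alpha> \<cdot>\<^sub>m P - H_mat n)) $$ (i, j)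
      = (if i = j then 0 else (a - q) / (1 + d)) - (a - H)"
    using ij P carrier_matD[OF H_mat_carrier]
    by (simp add: S_mat_def a_def q_def d_def H_def)
  show ?thesis
  proof (cases "i = j")
    case True
    then have "a = 0" "H = 0"
      using ij diag by (auto simp: a_def H_def H_mat_index)
    then show ?thesis
      unfolding entry using True p_nonneg alpha by simp
  next
    case False
    have "d / (1 + d) = 1 - 1 / (1 + d)"
      using d by (simp add: field_simps)
    then have "(a - q) / (1 + d) - (a - H) = (H - q / (1 + d)) - a * (d / (1 + d))"
      by (simp add: diff_divide_distrib right_diff_distrib)
    moreover have "0 \<le> q / (1 + d)"
      using d q by simp
    moreover have "q / (1 + d) \<le> q / 1"
      using d q by (intro divide_left_mono) auto
    moreover have "0 \<le> a * (d / (1 + d))"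
      using a d by simp
    moreover have "a * (d / (1 + d)) \<le> (\<alpha> * p) * (4 * R\<^sup>2)"
    proof (intro mult_mono)
      have "d / (1 + d) \<le> d / 1"
        using d by (intro divide_left_mono) auto
      then show "d / (1 + d) \<le> 4 * R\<^sup>2"
        using d by simp
    qed (use a d in auto)
    ultimately show ?thesis
      using False q H unfolding entry by (simp add: mult.commute abs_le_iff)
  qed
qed

text \<open>A bootstrap argument: the entry bound is available only within radius
  \<open>1 / 4\<close>, and the induction hypothesis together with \<open>small\<close> guarantees
  this radius before each step. The step then adds to each norm at most
  \<open>h * n * entry_bound\<close> times twice the current radius.\<close>

lemma norm_ee_iter_le:
  assumes h: "0 \<le> h" and R: "0 \<le> R" and y0: "\<And>i. i < n \<Longrightarrow> norm (y0 i) \<le> R"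
    and small: "(1 + 2 * (h * (real n * entry_bound))) ^ k * R \<le> 1 / 4"
    and m: "m \<le> k" and i: "i < n"
  shows "norm (ee_iter n P \<alpha> h y0 m i) \<le> (1 + 2 * (h * (real n * entry_bound))) ^ m * R"
  using m i
proof (induction m arbitrary: i)
  case 0
  then show ?case using y0 by simp
next
  case (Suc m)
  define b where "b = 2 * (h * (real n * entry_bound))"
  have b: "0 \<le> b" using h entry_bound_nonneg by (simp add: b_def)
  define y where "y = ee_iter n P \<alpha> h y0 m"
  define B where "B = (1 + b) ^ m * R"
  have B: "0 \<le> B" using b R by (simp add: B_def)
  have yB: "norm (y i) \<le> B" if "i < n" for i
    using Suc that by (simp add: y_def B_def b_def)
  have "B \<le> (1 + b) ^ k * R"
    unfolding B_def using b R Suc.prems by (intro mult_right_mono power_increasing) auto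
  then have B4: "norm (y i) \<le> 1 / 4" if "i < n" for i
    using yB[OF that] small by (simp add: b_def)
  have "norm (\<Sum>j\<in>{..<n} - {i}. S_mat n P \<alpha> y $$ (i, j) *\<^sub>R (y j - y i))
      \<le> (\<Sum>j\<in>{..<n} - {i}. entry_bound * (2 * B))"
  proof (rule sum_norm_le)
    fix j assume j: "j \<in> {..<n} - {i}"
    have "norm (y j - y i) \<le> 2 * B"
      using norm_triangle_ineq4[of "y j" "y i"] yB[of j] yB[of i] j Suc.prems by simp
    then show "norm (S_mat n P \<alpha> y $$ (i, j) *\<^sub>R (y j - y i)) \<le> entry_bound * (2 * B)"
      using S_mat_entry_le[where y = y and i = i and j = j, OF B4] j Suc.prems entry_bound_nonneg
      by (auto intro!: mult_mono)
  qed
  also have "\<dots> \<le> (\<Sum>j<n. entry_bound * (2 * B))"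
    using entry_bound_nonneg B by (intro sum_mono2) auto
  finally have "norm (h *\<^sub>R (\<Sum>j\<in>{..<n} - {i}. S_mat n P \<alpha> y $$ (i, j) *\<^sub>R (y j - y i)))
      \<le> h * (real n * (entry_bound * (2 * B)))"
    using h by (simp add: mult_left_mono)
  also have "\<dots> = b * B"
    by (simp add: b_def)
  finally have "norm (ee_iter n P \<alpha> h y0 (Suc m) i) \<le> B + b * B"
    using yB[OF Suc.prems(2)] norm_triangle_le[of "y i" _ "B + b * B"]
    by (simp add: Let_def flip: y_def)
  also have "\<dots> = (1 + b) ^ Suc m * R"
    by (simp add: B_def algebra_simps)
  finally show ?case by (simp add: b_def)
qed

text \<open>\<open>H_mat n\<close> has norm at most \<open>2 / n\<close>, so it can cancel little of
  \<open>\<alpha> P\<close>. This keeps the denominator of the first limit comparable to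
  \<open>\<alpha> * spectral_norm P\<close>.\<close>

lemma spectral_norm_le_limit:
  "\<alpha> * spectral_norm P \<le> spectral_norm (\<alpha> \<cdot>\<^sub>m P - H_mat n) + 2 / real n"
proof -
  have "spectral_norm (H_mat n) \<le> real n * (2 / (real n)\<^sup>2)"
    using H_entry_le by (intro spectral_norm_le_of_entries) auto
  then have "spectral_norm (H_mat n) \<le> 2 / real n"
    using n by (simp add: power2_eq_square)
  then show ?thesis
    using spectral_norm_smult_le[OF P H_mat_carrier alpha] by linarith
qed

text \<open>The regime reached for large \<open>n\<close>; \<open>e\<close> is the quantity that
  (iii) sends to 0. Points start within radius \<open>2 * M\<close>, and a growth factor of at most
  2 keeps them within \<open>4 * M\<close>, which is at most \<open>1 / 4\<close> as soon as
  \<open>M \<le> 1 / 16\<close>.\<close>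

context
  fixes h :: real and k :: nat and y0 :: "nat \<Rightarrow> real ^ 2" and M e :: real
  assumes h: "0 < h" and k: "1 \<le> k"
    and sym: "\<And>i j. i < n \<Longrightarrow> j < n \<Longrightarrow> P $$ (i, j) = P $$ (j, i)"
    and M: "M = max_coord_norm n y0" "M \<le> 1 / 16"
    and e: "e = real k * (real n * h * \<alpha> * p + h / real n)" "exp (16 * e) \<le> 2"
begin

lemma growth_le:
  assumes "m \<le> k + 1"
  shows "(1 + 2 * (h * (real n * entry_bound))) ^ m \<le> exp (16 * e)"
proof -
  define b where "b = 2 * (h * (real n * entry_bound))"
  have b: "0 \<le> b" using h entry_bound_nonneg by (simp add: b_def)
  have "b = 2 * (real n * h * \<alpha> * p) + 8 * (h / real n)"
    using n by (simp add: b_def entry_bound_def field_simps power2_eq_square)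
  also have "\<dots> \<le> 8 * (real n * h * \<alpha> * p + h / real n)"
    using h alpha p_nonneg by simp
  finally have "real k * b \<le> 8 * e"
    using mult_left_mono[of b "8 * (real n * h * \<alpha> * p + h / real n)" "real k"] by (simp add: e(1) mult.left_commute)
  moreover have "real m * b \<le> (2 * real k) * b"
    using assms k b by (intro mult_right_mono) auto
  ultimately have mb: "real m * b \<le> 16 * e"
    by simp
  have "(1 + b) ^ m \<le> exp b ^ m"
    using b by (intro power_mono) (auto simp: add.commute exp_ge_add_one_self)
  also have "\<dots> = exp (real m * b)"
    by (simp add: exp_of_nat_mult)
  also have "\<dots> \<le> exp (16 * e)"
    using mb by simp
  finally show ?thesis by (simp add: b_def)
qed

lemma norm_iterate_le:
  assumes "m \<le> k + 1" "i < n"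
  shows "norm (ee_iter n P \<alpha> h y0 m i) \<le> 4 * M"
proof -
  have M0: "0 \<le> M"
    using max_coord_norm_bounds(1)[of 0 n y0] n M by simp
  have *: "(1 + 2 * (h * (real n * entry_bound))) ^ m * (2 * M) \<le> 4 * M" if "m \<le> k + 1" for m
  proof -
    have "(1 + 2 * (h * (real n * entry_bound))) ^ m * (2 * M) \<le> 2 * (2 * M)"
      using growth_le[OF that] e(2) M0 by (intro mult_right_mono) auto
    then show ?thesis by simp
  qed
  have "norm (ee_iter n P \<alpha> h y0 m i) \<le> (1 + 2 * (h * (real n * entry_bound))) ^ m * (2 * M)"
  proof (rule norm_ee_iter_le[where k = "k + 1"])
    show "(1 + 2 * (h * (real n * entry_bound))) ^ (k + 1) * (2 * M) \<le> 1 / 4"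
      using *[of "k + 1"] M(2) by linarith
  qed (use h M0 M assms max_coord_norm_bounds(2)[of _ n y0] in auto)
  then show ?thesis using *[OF assms(1)] by linarith
qed

text \<open>All points lie within \<open>4 * M\<close> of the origin; doubling this gives the
  universal constant 8.\<close>

lemma diameter_iterate_le: "diameter (ee_iter n P \<alpha> h y0 (k + 1) ` {..<n}) \<le> 8 * M"
proof (rule diameter_le)
  show "ee_iter n P \<alpha> h y0 (k + 1) ` {..<n} \<noteq> {} \<or> 0 \<le> 8 * M"
    using n lessThan_empty_iff[of n] by auto
  fix u v assume "u \<in> ee_iter n P \<alpha> h y0 (k + 1) ` {..<n}" "v \<in> ee_iter n P \<alpha> h y0 (k + 1) ` {..<n}"
  then have "norm u \<le> 4 * M" "norm v \<le> 4 * M"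
    using norm_iterate_le[of "k + 1"] by auto
  then show "norm (u - v) \<le> 8 * M"
    using norm_triangle_ineq4[of u v] by linarith
qed

text \<open>The entrywise difference bound with \<open>R = 4 * M\<close>, so that 64 is 4 times 16.
  The product \<open>M\<^sup>2 * (n * p)\<close> is kept together because (ii) compares it with the
  norm of \<open>P\<close>.\<close>

lemma spectral_norm_S_mat_diff_le:
  "spectral_norm (S_mat n P \<alpha> (ee_iter n P \<alpha> h y0 k) - (\<alpha> \<cdot>\<^sub>m P - H_mat n))
    \<le> 64 * (\<alpha> * (M\<^sup>2 * (real n * p))) + 4 / real n"
proof -
  have "spectral_norm (S_mat n P \<alpha> (ee_iter n P \<alpha> h y0 k) - (\<alpha> \<cdot>\<^sub>m P - H_mat n))
      \<le> real n * (4 * (4 * M)\<^sup>2 * (\<alpha> * p) + 4 / (real n)\<^sup>2)"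
  proof (rule spectral_norm_le_of_entries)
    show "S_mat n P \<alpha> (ee_iter n P \<alpha> h y0 k) - (\<alpha> \<cdot>\<^sub>m P - H_mat n) \<in> carrier_mat n n"
      using P by (simp add: minus_carrier_mat)
    show "0 \<le> 4 * (4 * M)\<^sup>2 * (\<alpha> * p) + 4 / (real n)\<^sup>2"
      using alpha p_nonneg by simp
  qed (intro S_mat_diff_entry_le, use norm_iterate_le[of k] M in auto)
  also have "\<dots> = 64 * (\<alpha> * (M\<^sup>2 * (real n * p))) + 4 / real n"
    using n by (simp add: field_simps power2_eq_square)
  finally show ?thesis .
qed

lemma vec_l2_norm_iterate_diff_le:
  "vec_l2_norm (coord_vec n (ee_iter n P \<alpha> h y0 k) l -
      (1\<^sub>m n - h \<cdot>\<^sub>m laplacian (\<alpha> \<cdot>\<^sub>m P - H_mat n)) ^\<^sub>m k *\<^sub>v coord_vec n y0 l)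
    \<le> 2 * (exp (16 * e) - 1) * vec_l2_norm (coord_vec n y0 l)"
proof -
  define v where "v = coord_vec n y0 l"
  define w where "w j = coord_vec n (ee_iter n P \<alpha> h y0 j) l" for j
  define u where "u = (1\<^sub>m n - h \<cdot>\<^sub>m laplacian (\<alpha> \<cdot>\<^sub>m P - H_mat n)) ^\<^sub>m k *\<^sub>v v"
  have v: "v \<in> carrier_vec n" and w: "w j \<in> carrier_vec n" for j
    by (auto simp: v_def w_def coord_vec_def)
  have L: "\<alpha> \<cdot>\<^sub>m P - H_mat n \<in> carrier_mat n n"
    by (simp add: minus_carrier_mat)
  have u: "dim_vec u = n"
    using carrier_matD[OF laplacian_carrier[OF L]] by (simp add: u_def)
  have g: "((1 + 2 * (h * (real n * entry_bound))) ^ k - 1) * vec_l2_norm v \<le> (exp (16 * e) - 1) * vec_l2_norm v"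
    using growth_le[of k] by (intro mult_right_mono) auto
  have "vec_l2_norm (w k - w 0) \<le> ((1 + 2 * (h * (real n * entry_bound))) ^ k - 1) * vec_l2_norm (w 0)"
  proof (rule vec_l2_norm_laplacian_iterate_le[where A = "\<lambda>j. S_mat n P \<alpha> (ee_iter n P \<alpha> h y0 j)"])
    show "w (Suc j) = w j - h \<cdot>\<^sub>v (laplacian (S_mat n P \<alpha> (ee_iter n P \<alpha> h y0 j)) *\<^sub>v w j)" for j
      unfolding w_def by (rule coord_vec_ee_iter_Suc[OF sym])
    fix m i j assume "m < k" "i < n" "j < n"
    moreover have "norm (ee_iter n P \<alpha> h y0 m i) \<le> 1 / 4" if "i < n" for i
      using norm_iterate_le[of m i] that M(2) \<open>m < k\<close> by linarith
    ultimately show "\<bar>S_mat n P \<alpha> (ee_iter n P \<alpha> h y0 m) $$ (i, j)\<bar> \<le> entry_bound"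
      by (intro S_mat_entry_le)
  qed (use h entry_bound_nonneg w in auto)
  then have 1: "vec_l2_norm (w k - v) \<le> (exp (16 * e) - 1) * vec_l2_norm v"
    using g by (simp add: w_def v_def)
  have 2: "vec_l2_norm (u - v) \<le> (exp (16 * e) - 1) * vec_l2_norm v"
    using vec_l2_norm_pow_mat_laplacian_le[OF _ entry_bound_nonneg v L limit_entry_le, of h k] h g
    by (simp add: u_def)
  \<comment> \<open>Iterate and linearisation are both measured from the common start
    \<open>v\<close>; each contributes one \<open>exp (16 * e) - 1\<close>.\<close>
  have "w k - u = (w k - v) - (u - v)"
    using v w[of k] u by (intro eq_vecI) auto
  then have "vec_l2_norm (w k - u) \<le> vec_l2_norm (w k - v) + vec_l2_norm (u - v)"
    using vec_l2_norm_minus_le[of "w k - v" "u - v"] v by simp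
  then have "vec_l2_norm (w k - u) \<le> 2 * (exp (16 * e) - 1) * vec_l2_norm v"
    using 1 2 by linarith
  then show ?thesis
    by (simp only: w_def u_def v_def)
qed

end

end

section \<open>Positivity of the similarity matrix\<close>

lemma cond_sim_pos:
  assumes "2 \<le> n" "i < n"
  shows "0 < cond_sim n X \<tau> i j"
proof -
  \<comment> \<open>An index below \<open>n\<close> other than \<open>i\<close>, so that the
    normalising sum is not empty.\<close>
  have "(if i = 0 then 1 else 0) \<in> {..<n} - {i}"
    using assms by auto
  then have "{..<n} - {i} \<noteq> {}" by blast
  then show ?thesis
    unfolding cond_sim_def by (intro divide_pos_pos sum_pos) auto
qed

text \<open>A unit vector singles out the column that contains the nonzero entry.\<close>

lemma spectral_norm_pos:
  assumes A: "A \<in> carrier_mat n n" and ij: "i < n" "j < n" and nz: "A $$ (i, j) \<noteq> 0"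
  shows "0 < spectral_norm A"
proof -
  have "A *\<^sub>v unit_vec n j = col A j"
    using A ij by (intro eq_vecI) auto
  moreover have "vec_l2_norm (unit_vec n j) \<le> 1"
    using ij by (simp add: vec_l2_norm_def)
  ultimately have "vec_l2_norm (col A j) \<le> spectral_norm A"
    using vec_l2_norm_mult_le_spectral_norm[OF A, of "unit_vec n j"] by simp
  moreover have "\<not> (\<forall>i\<in>{..<n}. vec_index (col A j) i = 0)"
    using A ij nz by auto
  then have "0 < vec_l2_norm (col A j)"
    using A by (simp add: vec_l2_norm_eq_L2_set order.strict_iff_order L2_set_eq_0_iff eq_commute[of 0])
  ultimately show ?thesis by linarith
qed

text \<open>Makes the estimates of the locale available with \<open>p\<close> the largest entry of
  the similarity matrix.\<close>

lemma sim_mat_small_affinities: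
  assumes "2 \<le> n" and "0 < \<alpha>"
  shows "small_affinities n (sim_mat n X \<tau>) \<alpha> (mat_sup_norm (sim_mat n X \<tau>))"
proof
  fix i j assume ij: "i < n" "j < n"
  show "0 \<le> sim_mat n X \<tau> $$ (i, j)"
    using cond_sim_pos[OF assms(1)] ij by (simp add: sim_mat_def less_imp_le)
  show "sim_mat n X \<tau> $$ (i, j) \<le> mat_sup_norm (sim_mat n X \<tau>)"
    using abs_entry_le_mat_sup_norm[of i "sim_mat n X \<tau>" j] ij by (simp add: sim_mat_def)
qed (use assms in \<open>auto simp: sim_mat_def\<close>)

text \<open>The entry \<open>(0, 1)\<close> averages two positive conditional similarities, up to a
  factor \<open>1 / n\<close>. Positivity is needed for cancelling this norm in the quotients
  below.\<close>

lemma spectral_norm_sim_mat_pos: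
  assumes "2 \<le> n"
  shows "0 < spectral_norm (sim_mat n X \<tau>)"
proof (rule spectral_norm_pos[of _ n 0 1])
  show "sim_mat n X \<tau> $$ (0, 1) \<noteq> 0"
    using cond_sim_pos[OF assms, of 0 X \<tau> 1] cond_sim_pos[OF assms, of 1 X \<tau> 0] assms
    by (simp add: sim_mat_def)
qed (use assms in \<open>auto simp: sim_mat_def\<close>)

section \<open>Passage to the limit in the estimates for fixed \<open>n\<close>\<close>

theorem theorem4:
  shows "\<exists>C::real. C > 0 \<and>
    (\<forall>(p :: nat \<Rightarrow> nat) (X :: nat \<Rightarrow> nat \<Rightarrow> real Matrix.vec) (\<tau> :: nat \<Rightarrow> nat \<Rightarrow> real)
      (\<alpha> :: nat \<Rightarrow> real) (h :: nat \<Rightarrow> real) (k :: nat \<Rightarrow> nat) (y0 :: nat \<Rightarrow> nat \<Rightarrow> real ^ 2)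
      (P :: nat \<Rightarrow> real Matrix.mat) (y :: nat \<Rightarrow> nat \<Rightarrow> nat \<Rightarrow> real ^ 2).
      (\<forall>n\<ge>2. \<forall>i<n. X n i \<in> carrier_vec (p n) \<and> \<tau> n i > 0) \<longrightarrow>
      (\<forall>n\<ge>2. \<alpha> n > 0 \<and> h n > 0 \<and> k n \<ge> 1) \<longrightarrow>
      (\<forall>n. P n = sim_mat n (X n) (\<tau> n)) \<longrightarrow>
      (\<forall>n. y n = ee_iter n (P n) (\<alpha> n) (h n) (y0 n)) \<longrightarrow>
      (\<forall>n\<ge>2. (MIN l::2. vec_l2_norm (coord_vec n (y0 n) l)) > 0) \<longrightarrow>
      (\<lambda>n. max_coord_norm n (y0 n)) \<in> O(\<lambda>n. 1) \<longrightarrow>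
      (\<lambda>n. (max_coord_norm n (y0 n))\<^sup>2)
        \<in> o(\<lambda>n. spectral_norm (P n) / (real n * mat_sup_norm (P n))) \<longrightarrow>
      (\<lambda>n. inverse (real n * spectral_norm (P n))) \<in> o(\<alpha>) \<longrightarrow>
      (\<lambda>n. real (k n) * (real n * h n * \<alpha> n * mat_sup_norm (P n) + h n / real n))
        \<in> o(\<lambda>n. 1) \<longrightarrow>
      ((\<lambda>n. spectral_norm (S_mat n (P n) (\<alpha> n) (y n (k n)) - (\<alpha> n \<cdot>\<^sub>m P n - H_mat n))
             / spectral_norm (\<alpha> n \<cdot>\<^sub>m P n - H_mat n)) \<longlonglongrightarrow> 0) \<and>
      (\<forall>\<^sub>F n in sequentially.
         diameter (y n (k n + 1) ` {..<n}) \<le> C * max_coord_norm n (y0 n)) \<and>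
      (\<forall>l::2. (\<lambda>n. vec_l2_norm (coord_vec n (y n (k n)) l -
               (1\<^sub>m n - h n \<cdot>\<^sub>m laplacian (\<alpha> n \<cdot>\<^sub>m P n - H_mat n)) ^\<^sub>m k n
                 *\<^sub>v coord_vec n (y0 n) l)
             / vec_l2_norm (coord_vec n (y0 n) l)) \<longlonglongrightarrow> 0))"
\<comment> \<open>The constant 8 comes from \<open>diameter_iterate_le\<close> and is fixed before
  any of the sequences.\<close>
proof (intro exI[of _ 8] conjI allI impI)
  fix p X \<tau> \<alpha> h k y0 P y
  assume par: "\<forall>n\<ge>2. (\<alpha> :: nat \<Rightarrow> real) n > 0 \<and> (h :: nat \<Rightarrow> real) n > 0 \<and> (k :: nat \<Rightarrow> nat) n \<ge> 1"
    and P: "\<forall>n. P n = sim_mat n (X n) (\<tau> n)"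
    and y: "\<forall>n. y n = ee_iter n (P n) (\<alpha> n) (h n) (y0 n)"
    and init: "(\<lambda>n. (max_coord_norm n (y0 n))\<^sup>2)
        \<in> o(\<lambda>n. spectral_norm (P n) / (real n * mat_sup_norm (P n)))"
    and exaggeration: "(\<lambda>n. inverse (real n * spectral_norm (P n))) \<in> o(\<alpha>)"
    and iterations: "(\<lambda>n. real (k n) * (real n * h n * \<alpha> n * mat_sup_norm (P n) + h n / real n))
        \<in> o(\<lambda>n. 1)"
  define M where "M n = max_coord_norm n (y0 n)" for n
  define q where "q n = mat_sup_norm (P n)" for n
  define s where "s n = spectral_norm (P n)" for n
  \<comment> \<open>Hypothesis (ii) says that \<open>u\<close> tends to 0, and the two halves of
    (iii) say the same of \<open>v\<close> and \<open>e\<close>.\<close>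
  define e where "e n = real (k n) * (real n * h n * \<alpha> n * q n + h n / real n)" for n
  define u where "u n = (M n)\<^sup>2 / (s n / (real n * q n))" for n
  define v where "v n = inverse (real n * s n) / \<alpha> n" for n
  have u0: "u \<longlonglongrightarrow> 0"
    using smalloD_tendsto[OF init] by (simp add: u_def[abs_def] M_def q_def s_def)
  have v0: "v \<longlonglongrightarrow> 0"
    using smalloD_tendsto[OF exaggeration] by (simp add: v_def[abs_def] s_def)
  have e0: "e \<longlonglongrightarrow> 0"
    using smalloD_tendsto[OF iterations] by (simp add: e_def[abs_def] q_def)
  have exp0: "(\<lambda>n. exp (16 * e n)) \<longlonglongrightarrow> exp (16 * 0)"
    by (intro tendsto_intros e0)
  have aff: "small_affinities n (P n) (\<alpha> n) (q n)" if "2 \<le> n" for n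
    using sim_mat_small_affinities[OF that] par P that by (simp add: q_def)
  have s_pos: "0 < s n" if "2 \<le> n" for n
    using spectral_norm_sim_mat_pos[OF that] P by (simp add: s_def)
  \<comment> \<open>The quotient \<open>s n / (n * q n)\<close> in (ii) is therefore at most 1,
    which forces \<open>M\<close> to tend to 0.\<close>
  have s_le: "s n \<le> real n * q n" if n: "2 \<le> n" for n
  proof -
    interpret small_affinities n "P n" "\<alpha> n" "q n" by (rule aff[OF n])
    show ?thesis
      unfolding s_def using P nonneg le p_nonneg
      by (intro spectral_norm_le_of_entries) (auto simp: sim_mat_def)
  qed
  have sym: "P n $$ (i, j) = P n $$ (j, i)" if "i < n" "j < n" for n i j
    using that P by (simp add: sim_mat_def add.commute)

  have "\<forall>\<^sub>F n in sequentially. M n \<le> 1 / 16"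
  proof -
    \<comment> \<open>\<open>1 / 256\<close> is the square of the desired radius
      \<open>1 / 16\<close>.\<close>
    have "\<forall>\<^sub>F n in sequentially. u n < 1 / 256"
      using u0 by (rule order_tendstoD) simp
    then show ?thesis
      using eventually_ge_at_top[of 2]
    proof eventually_elim
      case (elim n)
      have r: "0 < s n / (real n * q n)" "s n / (real n * q n) \<le> 1"
        using s_pos[of n] s_le[of n] elim by (auto intro!: divide_pos_pos)
      have "(M n)\<^sup>2 < 1 / 256 * (s n / (real n * q n))"
        using elim(1) unfolding u_def pos_divide_less_eq[OF r(1)] .
      then have "(M n)\<^sup>2 \<le> (1 / 16)\<^sup>2"
        using r(2) unfolding power2_eq_square[of "1 / 16"] by linarith
      then show ?case by (rule power2_le_imp_le) simp
    qed
  qed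
  moreover have "\<forall>\<^sub>F n in sequentially. exp (16 * e n) < 2"
    using exp0 by (rule order_tendstoD) simp
  ultimately have good: "\<forall>\<^sub>F n in sequentially. 2 \<le> n \<and> M n \<le> 1 / 16 \<and> exp (16 * e n) \<le> 2"
    using eventually_ge_at_top[of 2] by eventually_elim auto

  show "(\<lambda>n. spectral_norm (S_mat n (P n) (\<alpha> n) (y n (k n)) - (\<alpha> n \<cdot>\<^sub>m P n - H_mat n))
      / spectral_norm (\<alpha> n \<cdot>\<^sub>m P n - H_mat n)) \<longlonglongrightarrow> 0" (is "?ratio \<longlonglongrightarrow> 0")
  proof (rule Lim_null_comparison)
    \<comment> \<open>This majorant is the bound on the numerator over the lower bound on the
      denominator, after cancelling \<open>A = \<alpha> n * s n\<close> from both.\<close>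
    have "(\<lambda>n. (64 * u n + 4 * v n) / (1 - 2 * v n)) \<longlonglongrightarrow> (64 * 0 + 4 * 0) / (1 - 2 * 0)"
      by (intro tendsto_intros u0 v0) simp
    then show "(\<lambda>n. (64 * u n + 4 * v n) / (1 - 2 * v n)) \<longlonglongrightarrow> 0"
      by simp
    \<comment> \<open>Keeps the lower bound \<open>A * (1 - 2 * v n)\<close> on the denominator
      positive.\<close>
    have "\<forall>\<^sub>F n in sequentially. v n < 1 / 2"
      using v0 by (rule order_tendstoD) simp
    then show "\<forall>\<^sub>F n in sequentially. norm (?ratio n) \<le> (64 * u n + 4 * v n) / (1 - 2 * v n)"
      using good
    proof eventually_elim
      case (elim n)
      then have n: "2 \<le> n" and v: "v n < 1 / 2" by auto
      interpret small_affinities n "P n" "\<alpha> n" "q n" by (rule aff[OF n])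
      define A where "A = \<alpha> n * s n"
      have A: "0 < A" using s_pos[OF n] alpha by (simp add: A_def)
      \<comment> \<open>The errors of order \<open>1 / n\<close>, which come from
        \<open>H_mat\<close> and the low-dimensional similarities, become multiples of
        \<open>A\<close>; this is where the growth condition on \<alpha> enters.\<close>
      have vA: "1 / real n = A * v n"
        using s_pos[OF n] alpha n by (simp add: A_def v_def field_simps)
      have uA: "\<alpha> n * ((M n)\<^sup>2 * (real n * q n)) = A * u n"
        using s_pos[OF n] by (simp add: A_def u_def)
      have "spectral_norm (S_mat n (P n) (\<alpha> n) (y n (k n)) - (\<alpha> n \<cdot>\<^sub>m P n - H_mat n))
          \<le> 64 * (\<alpha> n * ((M n)\<^sup>2 * (real n * q n))) + 4 / real n"
        using spectral_norm_S_mat_diff_le[of "h n" "k n" "M n" "y0 n" "e n"] par elim sym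
        by (simp add: y M_def e_def)
      also have "\<dots> = A * (64 * u n + 4 * v n)"
        using vA uA by (simp add: algebra_simps)
      finally have num: "spectral_norm (S_mat n (P n) (\<alpha> n) (y n (k n)) - (\<alpha> n \<cdot>\<^sub>m P n - H_mat n))
          \<le> A * (64 * u n + 4 * v n)" .
      have denom: "A * (1 - 2 * v n) \<le> spectral_norm (\<alpha> n \<cdot>\<^sub>m P n - H_mat n)"
        using spectral_norm_le_limit vA by (simp add: A_def s_def algebra_simps)
      have S_carrier: "S_mat n (P n) (\<alpha> n) (y n (k n)) - (\<alpha> n \<cdot>\<^sub>m P n - H_mat n) \<in> carrier_mat n n"
        by (simp add: minus_carrier_mat)
      have num0: "0 \<le> spectral_norm (S_mat n (P n) (\<alpha> n) (y n (k n)) - (\<alpha> n \<cdot>\<^sub>m P n - H_mat n))"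
        by (rule spectral_norm_nonneg[OF S_carrier])
      have pos: "0 < A * (1 - 2 * v n)"
        using A v by simp
      have "?ratio n \<le> (A * (64 * u n + 4 * v n)) / (A * (1 - 2 * v n))"
        by (rule frac_le[OF order_trans[OF num0 num] num pos denom])
      moreover have "0 \<le> ?ratio n"
        using num0 pos denom by (intro divide_nonneg_nonneg) linarith+
      moreover have "(A * (64 * u n + 4 * v n)) / (A * (1 - 2 * v n)) = (64 * u n + 4 * v n) / (1 - 2 * v n)"
        using A by (intro mult_divide_mult_cancel_left) simp
      ultimately show ?case by simp
    qed
  qed

  show "\<forall>\<^sub>F n in sequentially. diameter (y n (k n + 1) ` {..<n}) \<le> 8 * max_coord_norm n (y0 n)"
    using good
  proof eventually_elim
    case (elim n)
    then interpret small_affinities n "P n" "\<alpha> n" "q n" by (intro aff) auto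
    show ?case
      using diameter_iterate_le[of "h n" "k n" "M n" "y0 n" "e n"] par elim sym
      by (simp add: y M_def e_def)
  qed

  fix l :: 2
  show "(\<lambda>n. vec_l2_norm (coord_vec n (y n (k n)) l -
      (1\<^sub>m n - h n \<cdot>\<^sub>m laplacian (\<alpha> n \<cdot>\<^sub>m P n - H_mat n)) ^\<^sub>m k n *\<^sub>v coord_vec n (y0 n) l)
    / vec_l2_norm (coord_vec n (y0 n) l)) \<longlonglongrightarrow> 0" (is "?ratio \<longlonglongrightarrow> 0")
  proof (rule Lim_null_comparison)
    have "(\<lambda>n. 2 * (exp (16 * e n) - 1)) \<longlonglongrightarrow> 2 * (exp (16 * 0) - 1)"
      by (intro tendsto_intros e0)
    then show "(\<lambda>n. 2 * (exp (16 * e n) - 1)) \<longlonglongrightarrow> 0"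
      by simp
    show "\<forall>\<^sub>F n in sequentially. norm (?ratio n) \<le> 2 * (exp (16 * e n) - 1)"
      using good
    proof eventually_elim
      case (elim n)
      then have n: "2 \<le> n" by simp
      interpret small_affinities n "P n" "\<alpha> n" "q n" by (rule aff[OF n])
      \<comment> \<open>Makes the majorant nonnegative, which settles the case of a zero
        denominator, where the quotient is 0 by convention.\<close>
      have "0 \<le> e n"
        using par n p_nonneg by (simp add: e_def less_imp_le)
      moreover have "vec_l2_norm (coord_vec n (y n (k n)) l -
          (1\<^sub>m n - h n \<cdot>\<^sub>m laplacian (\<alpha> n \<cdot>\<^sub>m P n - H_mat n)) ^\<^sub>m k n *\<^sub>v coord_vec n (y0 n) l)
          \<le> 2 * (exp (16 * e n) - 1) * vec_l2_norm (coord_vec n (y0 n) l)"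
        using vec_l2_norm_iterate_diff_le[of "h n" "k n" "M n" "y0 n" "e n" l] par elim sym
        by (simp add: y M_def e_def)
      ultimately show ?case
        by (cases "vec_l2_norm (coord_vec n (y0 n) l) = 0")
          (auto simp: pos_divide_le_eq order.strict_iff_order)
    qed
  qed
qed simp

end
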